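(* Let $\Pi$ be an Eulerian digraph on a finite set $I$ with $|I|$ odd. Then there exists a game $\Gamma$ on $I$ which contains $\Pi$ as a subgraph, i.e. $\Pi \subset \Gamma$.
   Context: A digraph on $I$ is a relation $\Pi \subset I \times I$ with $\Pi \cap \Pi^{-1} = \emptyset$ (in particular no loops), where $\Pi^{-1}=\{(j,i):(i,j)\in\Pi\}$. Write $\Pi(i) = \{j : (i,j)\in \Pi\}$ and $\Pi^{-1}(i) = \{j : (j,i) \in \Pi\}$. The digraph is Eulerian when $|\Pi(i)| = |\Pi^{-1}(i)|$ for all $i \in I$ (the empty digraph is Eulerian). A tournament on $I$ is a digraph such that for every pair of distinct $i,j\in I$ exactly one of $(i,j),(j,i)$ is in it. A game on $I$ is a regular (equivalently Eulerian) tournament: $|I| = 2n+1$ and each $i \in I$ has exactly $n$ outputs and $n$ inputs. *)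

theory Defs
  imports Main
begin

definition digraph_on :: "'a set \<Rightarrow> 'a rel \<Rightarrow> bool" where
  "digraph_on I R \<longleftrightarrow> R \<subseteq> I \<times> I \<and> R \<inter> R\<inverse> = {}"

text \<open>\<open>R `` {i}\<close> is the set $R(i)$ of outputs of \<open>i\<close>, and \<open>R\<inverse> `` {i}\<close> the set
  $R^{-1}(i)$ of its inputs. Since \<open>card\<close> is \<open>0\<close> on infinite sets, the degree condition
  below has its intended meaning only for finite \<open>I\<close>.\<close>

definition eulerian_on :: "'a set \<Rightarrow> 'a rel \<Rightarrow> bool" where
  "eulerian_on I R \<longleftrightarrow> digraph_on I R \<and> (\<forall>i\<in>I. card (R `` {i}) = card (R\<inverse> `` {i}))"

definition tournament_on :: "'a set \<Rightarrow> 'a rel \<Rightarrow> bool" where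
  "tournament_on I R \<longleftrightarrow> digraph_on I R \<and>
     (\<forall>i\<in>I. \<forall>j\<in>I. i \<noteq> j \<longrightarrow> ((i, j) \<in> R \<longleftrightarrow> (j, i) \<notin> R))"

text \<open>The equation \<open>card I = 2 * n + 1\<close> forces \<open>I\<close> to be finite.\<close>

definition game_on :: "'a set \<Rightarrow> 'a rel \<Rightarrow> bool" where
  "game_on I R \<longleftrightarrow> tournament_on I R \<and>
     (\<exists>n. card I = 2 * n + 1 \<and> (\<forall>i\<in>I. card (R `` {i}) = n \<and> card (R\<inverse> `` {i}) = n))"

end

theory Submission
  imports Defs
begin

text \<open>The pairs of distinct points that \<open>\<Pi>\<close> leaves unrelated form a graph \<open>G\<close>. Its degrees are
  even, because \<open>card I - 1\<close> is even and every vertex has as many outputs as inputs in \<open>\<Pi>\<close>. It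
  therefore suffices to orient \<open>G\<close> such that outputs and inputs balance everywhere. Choose an
  orientation minimizing the total excess of outputs over inputs. If some \<open>v\<close> has more outputs
  than inputs, then, as no edge leaves the set of points reachable from \<open>v\<close>, some \<open>w\<close> in this
  set has fewer outputs than inputs. Reversing a path from \<open>v\<close> to \<open>w\<close> moves one output from \<open>v\<close>
  to \<open>w\<close>, and by parity this lowers the total excess, a contradiction.\<close>

text \<open>An undirected graph is encoded as a symmetric relation \<open>G\<close> holding both
  ordered pairs of each edge; \<open>F\<close> keeps exactly one of the two.\<close>

definition orients :: "'a rel \<Rightarrow> 'a rel \<Rightarrow> bool" where
  "orients F G \<longleftrightarrow> F \<inter> F\<inverse> = {} \<and> F \<union> F\<inverse> = G"

text \<open>Number the vertices injectively and direct every edge towards the larger number.\<close>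

lemma orients_exists:
  assumes "finite G" "sym G" "irrefl G"
  shows "\<exists>F. orients F G"
proof -
  obtain f :: "'a \<Rightarrow> nat" where f: "inj_on f (Field G)"
    using finite_imp_inj_to_nat_seg[OF finite_Field[OF assms(1)]] by blast
  have "f a < f b \<or> f b < f a" if "(a, b) \<in> G" for a b
  proof -
    have "a \<noteq> b" using that assms(3) by (auto simp: irrefl_def)
    moreover have "a \<in> Field G" "b \<in> Field G" using that by (auto simp: Field_def)
    ultimately have "f a \<noteq> f b" using f by (auto dest: inj_onD)
    then show ?thesis by linarith
  qed
  then have "orients {(a, b) \<in> G. f a < f b} G"
    using assms(2) by (auto simp: orients_def dest: symD)
  then show ?thesis by blast
qed

lemma card_Image_insert:
  assumes "finite F" "(x, y) \<notin> F"
  shows "card (insert (x, y) F `` {i}) = card (F `` {i}) + of_bool (i = x)"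
proof (cases "i = x")
  case True
  then have "insert (x, y) F `` {i} = insert y (F `` {i})" by auto
  then show ?thesis using assms True by (simp add: finite_Image)
next
  case False
  then have "insert (x, y) F `` {i} = F `` {i}" by auto
  then show ?thesis using False by simp
qed

text \<open>Start the path at its last visit to \<open>v\<close>; the rest then survives the removal
  of its first edge, as the induction on edges below requires.\<close>

lemma rtrancl_first_edge:
  assumes "(v, w) \<in> F\<^sup>*" "v \<noteq> w"
  shows "\<exists>x. (v, x) \<in> F \<and> (x, w) \<in> (F - {(v, x)})\<^sup>*"
proof -
  have "v = w \<or> (\<exists>x. (v, x) \<in> F \<and> (x, w) \<in> (F - {(v, x)})\<^sup>*)"
    using assms(1)
  proof (induction rule: rtrancl_induct)
    case base
    then show ?case by simp
  next
    case (step y z)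
    show ?case
    proof (cases "y = v")
      case True
      \<comment> \<open>The path has come back to \<open>v\<close>, so what precedes is dropped:
        \<open>z\<close> becomes the new \<open>x\<close>, with an empty remainder.\<close>
      then show ?thesis using step.hyps by blast
    next
      case False
      then obtain x where x: "(v, x) \<in> F" "(x, y) \<in> (F - {(v, x)})\<^sup>*"
        using step.IH by blast
      moreover have "(y, z) \<in> F - {(v, x)}" using False step.hyps by auto
      ultimately show ?thesis by (meson rtrancl.rtrancl_into_rtrancl)
    qed
  qed
  then show ?thesis using assms(2) by blast
qed

text \<open>Path reversal by induction on the number of edges: remove the first edge
  \<open>(v, x)\<close>, shift an output from \<open>x\<close> to \<open>w\<close> in what is left,
  and put the edge back as \<open>(x, v)\<close>. Only outputs are tracked, since \<open>G\<close>
  fixes the sum of outputs and inputs.\<close>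

lemma orients_shift_output:
  assumes "finite F" "orients F G" "(v, w) \<in> F\<^sup>*"
  shows "\<exists>F'. orients F' G \<and>
    (\<forall>i. card (F' `` {i}) + of_bool (i = v) = card (F `` {i}) + of_bool (i = w))"
  using assms
proof (induction "card F" arbitrary: F G v rule: less_induct)
  case less
  show ?case
  proof (cases "v = w")
    case True
    then show ?thesis using less.prems by auto
  next
    case False
    then obtain x where x: "(v, x) \<in> F" "(x, w) \<in> (F - {(v, x)})\<^sup>*"
      using rtrancl_first_edge less.prems(3) by meson
    define F0 where "F0 = F - {(v, x)}"
    have F: "F = insert (v, x) F0" "(v, x) \<notin> F0" "finite F0"
      using x less.prems(1) by (auto simp: F0_def)
    then have "card F0 < card F" by simp
    moreover have "orients F0 (F0 \<union> F0\<inverse>)"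
      using less.prems(2) by (auto simp: orients_def F0_def)
    ultimately obtain F1 where F1: "orients F1 (F0 \<union> F0\<inverse>)"
      and deg: "\<And>i. card (F1 `` {i}) + of_bool (i = x) = card (F0 `` {i}) + of_bool (i = w)"
      using less.hyps[of F0 "F0 \<union> F0\<inverse>" x] F(3) x(2) by (auto simp: F0_def)
    have F1_eq: "F1 \<union> F1\<inverse> = F0 \<union> F0\<inverse>" "F1 \<inter> F1\<inverse> = {}"
      using F1 by (auto simp: orients_def)
    have F_eq: "F \<union> F\<inverse> = G" "F \<inter> F\<inverse> = {}"
      using less.prems(2) by (auto simp: orients_def)
    \<comment> \<open>The smaller graph has no edge between \<open>v\<close> and \<open>x\<close>,
      so \<open>(x, v)\<close> meets no opposite pair in \<open>F1\<close> and counts as a new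
      output of \<open>x\<close>.\<close>
    have new: "(v, x) \<notin> F0 \<union> F0\<inverse>" "v \<noteq> x" using F F_eq by blast+
    then have notin: "(x, v) \<notin> F1" "(v, x) \<notin> F1" using F1_eq by blast+
    have "finite F1" using F1_eq(1) F(3) by (metis finite_Un finite_converse)
    then have "card (insert (x, v) F1 `` {i}) + of_bool (i = v) = card (F `` {i}) + of_bool (i = w)" for i
      using deg[of i] card_Image_insert[of F1 x v i] card_Image_insert[of F0 v x i] F notin
      by simp
    moreover have "orients (insert (x, v) F1) G"
      unfolding orients_def
    proof
      show "insert (x, v) F1 \<inter> (insert (x, v) F1)\<inverse> = {}"
        using notin F1_eq(2) new(2) by blast
      have "insert (x, v) F1 \<union> (insert (x, v) F1)\<inverse> = insert (x, v) (insert (v, x) (F1 \<union> F1\<inverse>))"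
        by auto
      also have "\<dots> = F \<union> F\<inverse>" unfolding F1_eq(1) F(1) by auto
      finally show "insert (x, v) F1 \<union> (insert (x, v) F1)\<inverse> = G" using F_eq(1) by simp
    qed
    ultimately show ?thesis by blast
  qed
qed

lemma sum_card_Image:
  assumes "finite F" "finite S"
  shows "(\<Sum>i\<in>S. card (F `` {i})) = card {(a, b) \<in> F. a \<in> S}"
proof -
  have "{(a, b) \<in> F. a \<in> S} = (SIGMA i:S. F `` {i})" by auto
  then show ?thesis using assms by (simp add: card_SigmaI finite_Image)
qed

lemma sum_card_converse_Image:
  assumes "finite F" "finite S"
  shows "(\<Sum>i\<in>S. card (F\<inverse> `` {i})) = card {(a, b) \<in> F. b \<in> S}"
proof -
  have "{(a, b) \<in> F\<inverse>. a \<in> S} = {(a, b) \<in> F. b \<in> S}\<inverse>" by auto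
  then have "card {(a, b) \<in> F\<inverse>. a \<in> S} = card {(a, b) \<in> F. b \<in> S}"
    by (simp only: card_inverse)
  then show ?thesis using sum_card_Image[of "F\<inverse>" S] assms by simp
qed

text \<open>Every edge that starts in the reachable set also ends there. Counting edges by start and
  by end shows that outputs cannot exceed inputs in total over this set, so the excess at
  \<open>v\<close> must be compensated.\<close>

lemma reachable_deficit:
  assumes "finite F" "card (F\<inverse> `` {v}) < card (F `` {v})"
  shows "\<exists>w. (v, w) \<in> F\<^sup>* \<and> card (F `` {w}) < card (F\<inverse> `` {w})"
proof (rule ccontr)
  assume no: "\<not> ?thesis"
  define S where "S = F\<^sup>* `` {v}"
  have "S \<subseteq> insert v (Range F)"
    by (auto simp: S_def elim: rtranclE)
  then have S: "finite S" using assms(1) by (meson finite_Range finite_insert finite_subset)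
  have "v \<in> S" by (simp add: S_def)
  moreover have "card (F\<inverse> `` {w}) \<le> card (F `` {w})" if "w \<in> S" for w
    using no that by (auto simp: S_def not_less)
  ultimately have "(\<Sum>i\<in>S. card (F\<inverse> `` {i})) < (\<Sum>i\<in>S. card (F `` {i}))"
    using S assms(2) by (intro sum_strict_mono_ex1) auto
  moreover have "{(a, b) \<in> F. a \<in> S} \<subseteq> {(a, b) \<in> F. b \<in> S}"
    by (auto simp: S_def intro: rtrancl_into_rtrancl)
  then have "card {(a, b) \<in> F. a \<in> S} \<le> card {(a, b) \<in> F. b \<in> S}"
    by (rule card_mono[rotated]) (rule finite_subset[OF _ assms(1)], auto)
  ultimately show False
    using sum_card_Image[OF assms(1) S] sum_card_converse_Image[OF assms(1) S] by simp
qed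

lemma orients_card_Image:
  assumes "finite F" "orients F G"
  shows "card (F `` {i}) + card (F\<inverse> `` {i}) = card (G `` {i})"
proof -
  have "G `` {i} = F `` {i} \<union> F\<inverse> `` {i}" "F `` {i} \<inter> F\<inverse> `` {i} = {}"
    using assms(2) by (auto simp: orients_def)
  then show ?thesis using assms(1) by (simp add: card_Un_disjoint finite_Image)
qed

lemma balanced_orientation_exists:
  assumes G: "finite G" "sym G" "irrefl G" and even: "\<And>i. even (card (G `` {i}))"
  shows "\<exists>F. orients F G \<and> (\<forall>i. card (F `` {i}) = card (F\<inverse> `` {i}))"
proof -
  define V where "V = Field G"
  \<comment> \<open>Truncated subtraction: only vertices with more outputs than inputs contribute.\<close>
  define m where "m F = (\<Sum>i\<in>V. card (F `` {i}) - card (F\<inverse> `` {i}))" for F :: "'a rel"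
  obtain F where F: "orients F G" and least: "\<And>F'. orients F' G \<Longrightarrow> m F \<le> m F'"
    using orients_exists[OF G] ex_has_least_nat[of "\<lambda>F. orients F G" _ m] by blast
  have V: "finite V" using G(1) by (simp add: V_def finite_Field)
  have fin: "finite F'" if "orients F' G" for F'
    using that G(1) by (auto simp: orients_def)
  note deg = orients_card_Image[OF fin]
  have le: "card (F `` {v}) \<le> card (F\<inverse> `` {v})" for v
  proof (rule ccontr)
    assume "\<not> ?thesis"
    then have v: "card (F\<inverse> `` {v}) < card (F `` {v})" by simp
    then obtain w where vw: "(v, w) \<in> F\<^sup>*" and w: "card (F `` {w}) < card (F\<inverse> `` {w})"
      using reachable_deficit[OF fin[OF F]] by blast
    from orients_shift_output[OF fin[OF F] F vw]
    obtain F' where F': "orients F' G"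
      and eq: "\<And>i. card (F' `` {i}) + of_bool (i = v) = card (F `` {i}) + of_bool (i = w)"
      by blast
    have vV: "v \<in> V"
    proof -
      have "F `` {v} \<noteq> {}" using v by (metis card.empty less_nat_zero_code)
      then show ?thesis using F by (auto simp: V_def orients_def Field_def)
    qed
    have vw_neq: "v \<noteq> w" using v w by auto
    \<comment> \<open>Outputs and inputs add up to an even degree, so they differ by an even number,
      hence by at least 2 if they differ.\<close>
    have v2: "card (F\<inverse> `` {v}) + 2 \<le> card (F `` {v})"
      using v deg[OF F F, of v] even[of v] by presburger
    have w2: "card (F `` {w}) + 2 \<le> card (F\<inverse> `` {w})"
      using w deg[OF F F, of w] even[of w] by presburger
    \<comment> \<open>Losing one output means gaining one input, so the excess at \<open>v\<close>
      falls by exactly 2. At \<open>w\<close> it rises by 2, but by \<open>w2\<close> it stays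
      nonpositive and still contributes 0 to \<open>m\<close>.\<close>
    have drop: "card (F' `` {v}) - card (F'\<inverse> `` {v}) < card (F `` {v}) - card (F\<inverse> `` {v})"
      using v2 eq[of v] vw_neq deg[OF F F, of v] deg[OF F' F', of v] by simp
    have "card (F' `` {i}) - card (F'\<inverse> `` {i}) \<le> card (F `` {i}) - card (F\<inverse> `` {i})" for i
    proof -
      consider "i = v" | "i = w" | "i \<noteq> v" "i \<noteq> w" by blast
      then show ?thesis
      proof cases
        case 1
        then show ?thesis using drop by simp
      next
        case 2
        then show ?thesis
          using w2 eq[of w] vw_neq deg[OF F F, of w] deg[OF F' F', of w] by simp
      next
        case 3
        then show ?thesis
          using eq[of i] deg[OF F F, of i] deg[OF F' F', of i] by simp
      qed
    qed
    then have "m F' < m F"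
      unfolding m_def using V vV drop by (intro sum_strict_mono_ex1) auto
    then show False using least[OF F'] by simp
  qed
  \<comment> \<open>A deficit at \<open>i\<close> is an excess in the converse relation, where some
    reachable \<open>w\<close> has a deficit. That is an excess of \<open>w\<close> in
    \<open>F\<close>, against \<open>le\<close>.\<close>
  have "card (F `` {i}) = card (F\<inverse> `` {i})" for i
  proof (rule ccontr)
    assume "\<not> ?thesis"
    then have "card ((F\<inverse>)\<inverse> `` {i}) < card (F\<inverse> `` {i})" using le[of i] by simp
    then obtain w where "card (F\<inverse> `` {w}) < card (F `` {w})"
      using reachable_deficit[of "F\<inverse>" i] fin[OF F] by auto
    then show False using le[of w] by simp
  qed
  then show ?thesis using F by blast
qed

theorem theorem2p7:
  fixes I :: "'a set" and \<Pi> :: "'a rel"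
  assumes "finite I" and "odd (card I)" and "eulerian_on I \<Pi>"
  shows "\<exists>\<Gamma>. game_on I \<Gamma> \<and> \<Pi> \<subseteq> \<Gamma>"
proof -
  have sub: "\<Pi> \<subseteq> I \<times> I" and asym: "\<Pi> \<inter> \<Pi>\<inverse> = {}"
    and bal: "\<And>i. i \<in> I \<Longrightarrow> card (\<Pi> `` {i}) = card (\<Pi>\<inverse> `` {i})"
    using assms(3) by (auto simp: eulerian_on_def digraph_on_def)
  have fin: "finite \<Pi>" using sub assms(1) by (meson finite_SigmaI finite_subset)
  obtain n where n: "card I = 2 * n + 1" using assms(2) by (rule oddE)
  define G where "G = I \<times> I - Id - (\<Pi> \<union> \<Pi>\<inverse>)"
  have G: "finite G" "sym G" "irrefl G"
    using assms(1) by (auto simp: G_def sym_def irrefl_def)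
  \<comment> \<open>The \<open>2 * n\<close> other points split into neighbours in \<open>G\<close>,
    outputs in \<open>\<Pi>\<close> and inputs in \<open>\<Pi>\<close>, the last two being equally
    many.\<close>
  have Gdeg: "card (G `` {i}) + 2 * card (\<Pi> `` {i}) = 2 * n" if i: "i \<in> I" for i
  proof -
    have "I - {i} = G `` {i} \<union> (\<Pi> `` {i} \<union> \<Pi>\<inverse> `` {i})"
      using i sub asym by (auto simp: G_def)
    moreover have "G `` {i} \<inter> (\<Pi> `` {i} \<union> \<Pi>\<inverse> `` {i}) = {}" by (auto simp: G_def)
    moreover have "\<Pi> `` {i} \<inter> \<Pi>\<inverse> `` {i} = {}" using asym by auto
    ultimately have "card (I - {i}) = card (G `` {i}) + (card (\<Pi> `` {i}) + card (\<Pi>\<inverse> `` {i}))"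
      using G(1) fin by (simp add: card_Un_disjoint finite_Image)
    then show ?thesis using bal[OF i] n i by simp
  qed
  have "even (card (G `` {i}))" for i
  proof (cases "i \<in> I")
    case True
    then show ?thesis using Gdeg[of i] by presburger
  next
    case False
    then have "G `` {i} = {}" by (auto simp: G_def)
    then show ?thesis by simp
  qed
  then obtain F where F: "orients F G" and Fbal: "\<And>i. card (F `` {i}) = card (F\<inverse> `` {i})"
    using balanced_orientation_exists[OF G] by blast
  have F_eq: "F \<inter> F\<inverse> = {}" "F \<union> F\<inverse> = G" using F by (auto simp: orients_def)
  have finF: "finite F" using F_eq(2) G(1) by (metis finite_Un)
  have disj: "F \<inter> \<Pi> = {}" "F \<inter> \<Pi>\<inverse> = {}" using F_eq(2) by (auto simp: G_def)
  let ?\<Gamma> = "\<Pi> \<union> F"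
  have dig: "digraph_on I ?\<Gamma>"
    unfolding digraph_on_def
  proof
    show "?\<Gamma> \<subseteq> I \<times> I" using sub F_eq(2) by (auto simp: G_def)
    show "?\<Gamma> \<inter> ?\<Gamma>\<inverse> = {}" using asym F_eq(1) disj by blast
  qed
  have total: "(i, j) \<in> ?\<Gamma> \<or> (j, i) \<in> ?\<Gamma>" if "i \<in> I" "j \<in> I" "i \<noteq> j" for i j
  proof -
    have "(i, j) \<in> F \<union> F\<inverse> \<union> (\<Pi> \<union> \<Pi>\<inverse>)"
      unfolding F_eq(2) using that by (auto simp: G_def)
    then show ?thesis by blast
  qed
  have "tournament_on I ?\<Gamma>"
    unfolding tournament_on_def using dig total by (auto simp: digraph_on_def)
  moreover have "card (?\<Gamma> `` {i}) = n \<and> card (?\<Gamma>\<inverse> `` {i}) = n" if i: "i \<in> I" for i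
  proof -
    have "?\<Gamma> `` {i} = \<Pi> `` {i} \<union> F `` {i}" "?\<Gamma>\<inverse> `` {i} = \<Pi>\<inverse> `` {i} \<union> F\<inverse> `` {i}" by auto
    moreover have "\<Pi> `` {i} \<inter> F `` {i} = {}" "\<Pi>\<inverse> `` {i} \<inter> F\<inverse> `` {i} = {}"
      using disj by auto
    ultimately have "card (?\<Gamma> `` {i}) = card (\<Pi> `` {i}) + card (F `` {i})"
      "card (?\<Gamma>\<inverse> `` {i}) = card (\<Pi>\<inverse> `` {i}) + card (F\<inverse> `` {i})"
      using fin finF by (simp_all add: card_Un_disjoint finite_Image)
    \<comment> \<open>Balance gives \<open>F\<close> half of the degree of \<open>G\<close> at
      \<open>i\<close> as outputs and half as inputs; \<open>Gdeg\<close> halved then yields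
      \<open>n\<close> each way.\<close>
    then show ?thesis
      using Gdeg[OF i] bal[OF i] Fbal[of i] orients_card_Image[OF finF F, of i] by simp
  qed
  ultimately have "game_on I ?\<Gamma>" using n by (auto simp: game_on_def)
  then show ?thesis by blast
qed

end
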